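(* Let $F\colon\mathcal{C}\to\mathcal{D}$ be a functor between small categories and let $X\colon\mathcal{D}\to\mathbf{Set}$ be a functor. Put $\Delta_FX=X\circ F\colon\mathcal{C}\to\mathbf{Set}$. Then $$\mathrm{dsecat}(\pi_{\Delta_FX})\leq\mathrm{dsecat}(\pi_X).$$
   Context: For a functor $X\colon\mathcal{C}\to\mathbf{Set}$ on a small category, the category of elements $\int^{\mathcal{C}}X$ has objects $(c,x)$ with $x\in X(c)$; a morphism $(c,x)\to(d,y)$ is a morphism $f\colon c\to d$ in $\mathcal{C}$ with $X(f)(x)=y$. The functor $\pi_X\colon\int^{\mathcal{C}}X\to\mathcal{C}$ is the projection $(c,x)\mapsto c$. A cover of a category $\mathcal{B}$ is a family of (not necessarily full) subcategories such that every morphism of $\mathcal{B}$ belongs to at least one of them. For a functor $P\colon\mathcal{E}\to\mathcal{B}$, the directed sectional category $\mathrm{dsecat}(P)$ is the least integer $n\geq0$ for which $\mathcal{B}$ admits a cover $\{\mathcal{U}_0,\dots,\mathcal{U}_n\}$ and, for every $i$, a functor $s_i\colon\mathcal{U}_i\to\mathcal{E}$ together with a natural transformation $P s_i\Rightarrow\iota_i$, where $\iota_i\colon\mathcal{U}_i\hookrightarrow\mathcal{B}$ is the inclusion; it is $\infty$ if no such finite cover exists. *)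

theory Defs
  imports Main "HOL-Library.Extended_Nat" "HOL-Library.FuncSet"
begin

text \<open>
  Categories are carried by sets, hence small. The operations are total functions that are
  meaningful only on the carriers; \<open>Comp C g f\<close> is the composite of \<open>f\<close> followed by \<open>g\<close>.
\<close>

record ('o, 'a) cat =
  Ob :: "'o set"
  Ar :: "'a set"
  Dom :: "'a \<Rightarrow> 'o"
  Cod :: "'a \<Rightarrow> 'o"
  Idn :: "'o \<Rightarrow> 'a"
  Comp :: "'a \<Rightarrow> 'a \<Rightarrow> 'a"

locale category =
  fixes C :: "('o, 'a) cat"
  assumes Dom_Ob: "f \<in> Ar C \<Longrightarrow> Dom C f \<in> Ob C"
    and Cod_Ob: "f \<in> Ar C \<Longrightarrow> Cod C f \<in> Ob C"
    and Idn_Ar: "c \<in> Ob C \<Longrightarrow> Idn C c \<in> Ar C"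
    and Dom_Idn: "c \<in> Ob C \<Longrightarrow> Dom C (Idn C c) = c"
    and Cod_Idn: "c \<in> Ob C \<Longrightarrow> Cod C (Idn C c) = c"
    and Comp_Ar: "\<lbrakk>f \<in> Ar C; g \<in> Ar C; Cod C f = Dom C g\<rbrakk> \<Longrightarrow> Comp C g f \<in> Ar C"
    and Dom_Comp: "\<lbrakk>f \<in> Ar C; g \<in> Ar C; Cod C f = Dom C g\<rbrakk> \<Longrightarrow> Dom C (Comp C g f) = Dom C f"
    and Cod_Comp: "\<lbrakk>f \<in> Ar C; g \<in> Ar C; Cod C f = Dom C g\<rbrakk> \<Longrightarrow> Cod C (Comp C g f) = Cod C g"
    and Comp_Idn_right: "f \<in> Ar C \<Longrightarrow> Comp C f (Idn C (Dom C f)) = f"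
    and Comp_Idn_left: "f \<in> Ar C \<Longrightarrow> Comp C (Idn C (Cod C f)) f = f"
    and Comp_assoc: "\<lbrakk>f \<in> Ar C; g \<in> Ar C; h \<in> Ar C; Cod C f = Dom C g; Cod C g = Dom C h\<rbrakk>
      \<Longrightarrow> Comp C h (Comp C g f) = Comp C (Comp C h g) f"

record ('o, 'a, 'p, 'b) fctr =
  omap :: "'o \<Rightarrow> 'p"
  amap :: "'a \<Rightarrow> 'b"

locale is_functor = source: category C + target: category D
  for C :: "('o, 'a) cat" and D :: "('p, 'b) cat" +
  fixes F :: "('o, 'a, 'p, 'b) fctr"
  assumes omap_Ob: "c \<in> Ob C \<Longrightarrow> omap F c \<in> Ob D"
    and amap_Ar: "f \<in> Ar C \<Longrightarrow> amap F f \<in> Ar D"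
    and Dom_amap: "f \<in> Ar C \<Longrightarrow> Dom D (amap F f) = omap F (Dom C f)"
    and Cod_amap: "f \<in> Ar C \<Longrightarrow> Cod D (amap F f) = omap F (Cod C f)"
    and amap_Idn: "c \<in> Ob C \<Longrightarrow> amap F (Idn C c) = Idn D (omap F c)"
    and amap_Comp: "\<lbrakk>f \<in> Ar C; g \<in> Ar C; Cod C f = Dom C g\<rbrakk>
      \<Longrightarrow> amap F (Comp C g f) = Comp D (amap F g) (amap F f)"

definition fcomp :: "('p, 'b, 'q, 'e) fctr \<Rightarrow> ('o, 'a, 'p, 'b) fctr \<Rightarrow> ('o, 'a, 'q, 'e) fctr"
    (infixr "\<circ>\<^sub>F" 75)
  where "G \<circ>\<^sub>F F = \<lparr>omap = omap G \<circ> omap F, amap = amap G \<circ> amap F\<rparr>"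

locale nat_transf = dom_functor: is_functor C D F + cod_functor: is_functor C D G
  for C :: "('o, 'a) cat" and D :: "('p, 'b) cat"
    and F :: "('o, 'a, 'p, 'b) fctr" and G :: "('o, 'a, 'p, 'b) fctr" +
  fixes \<eta> :: "'o \<Rightarrow> 'b"
  assumes component_Ar: "c \<in> Ob C \<Longrightarrow> \<eta> c \<in> Ar D"
    and Dom_component: "c \<in> Ob C \<Longrightarrow> Dom D (\<eta> c) = omap F c"
    and Cod_component: "c \<in> Ob C \<Longrightarrow> Cod D (\<eta> c) = omap G c"
    and naturality: "f \<in> Ar C
      \<Longrightarrow> Comp D (amap G f) (\<eta> (Dom C f)) = Comp D (\<eta> (Cod C f)) (amap F f)"

text \<open>
  The category of sets whose elements are drawn from the type \<open>'x\<close>. A map \<open>A \<rightarrow> B\<close> is a triple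
  \<open>(A, h, B)\<close>, where \<open>h\<close> is \<open>undefined\<close> outside \<open>A\<close>, so that maps agreeing on \<open>A\<close> are equal.
  A set-valued functor on a small category takes only a set of values, so it factors through
  this category once \<open>'x\<close> is large enough; \<open>'x\<close> is left arbitrary throughout.
\<close>

type_synonym 'x set_map = "'x set \<times> ('x \<Rightarrow> 'x) \<times> 'x set"

definition set_cat :: "('x set, 'x set_map) cat"
  where "set_cat = \<lparr>
    Ob = UNIV,
    Ar = {(A, h, B). h \<in> A \<rightarrow>\<^sub>E B},
    Dom = (\<lambda>(A, h, B). A),
    Cod = (\<lambda>(A, h, B). B),
    Idn = (\<lambda>A. (A, \<lambda>x\<in>A. x, A)),
    Comp = (\<lambda>(B', k, C) (A, h, B). (A, compose A k h, C))\<rparr>"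

definition app :: "'x set_map \<Rightarrow> 'x \<Rightarrow> 'x"
  where "app m = fst (snd m)"

text \<open>
  A morphism \<open>(c, x) \<rightarrow> (d, y)\<close> of the category of elements is the triple of its source, the
  underlying morphism \<open>f : c \<rightarrow> d\<close> and its target, since \<open>f\<close> alone does not determine \<open>x\<close>.
\<close>

definition elements ::
    "('o, 'a) cat \<Rightarrow> ('o, 'a, 'x set, 'x set_map) fctr
      \<Rightarrow> ('o \<times> 'x, ('o \<times> 'x) \<times> 'a \<times> ('o \<times> 'x)) cat"
  where "elements C X = \<lparr>
    Ob = {(c, x). c \<in> Ob C \<and> x \<in> omap X c},
    Ar = {((c, x), f, (d, y)). c \<in> Ob C \<and> x \<in> omap X c \<and> d \<in> Ob C \<and> y \<in> omap X d \<and>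
            f \<in> Ar C \<and> Dom C f = c \<and> Cod C f = d \<and> app (amap X f) x = y},
    Dom = (\<lambda>(p, f, q). p),
    Cod = (\<lambda>(p, f, q). q),
    Idn = (\<lambda>(c, x). ((c, x), Idn C c, (c, x))),
    Comp = (\<lambda>(q', g, r) (p, f, q). (p, Comp C g f, r))\<rparr>"

definition elements_proj :: "('o \<times> 'x, ('o \<times> 'x) \<times> 'a \<times> ('o \<times> 'x), 'o, 'a) fctr"
  where "elements_proj = \<lparr>omap = fst, amap = (\<lambda>(p, f, q). f)\<rparr>"

definition subcategory :: "('o, 'a) cat \<Rightarrow> ('o, 'a) cat \<Rightarrow> bool"
  where "subcategory U B \<longleftrightarrow> category U \<and> category B \<and> Ob U \<subseteq> Ob B \<and> Ar U \<subseteq> Ar B \<and>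
    (\<forall>f\<in>Ar U. Dom U f = Dom B f \<and> Cod U f = Cod B f) \<and>
    (\<forall>c\<in>Ob U. Idn U c = Idn B c) \<and>
    (\<forall>f\<in>Ar U. \<forall>g\<in>Ar U. Cod U f = Dom U g \<longrightarrow> Comp U g f = Comp B g f)"

definition inclusion :: "('o, 'a, 'o, 'a) fctr"
  where "inclusion = \<lparr>omap = (\<lambda>c. c), amap = (\<lambda>f. f)\<rparr>"

definition is_cover :: "'i set \<Rightarrow> ('i \<Rightarrow> ('o, 'a) cat) \<Rightarrow> ('o, 'a) cat \<Rightarrow> bool"
  where "is_cover I U B \<longleftrightarrow> (\<forall>i\<in>I. subcategory (U i) B) \<and> (\<forall>f\<in>Ar B. \<exists>i\<in>I. f \<in> Ar (U i))"

definition has_sectional_cover ::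
    "('e, 'm) cat \<Rightarrow> ('o, 'a) cat \<Rightarrow> ('e, 'm, 'o, 'a) fctr \<Rightarrow> nat \<Rightarrow> bool"
  where "has_sectional_cover E B P n \<longleftrightarrow>
    (\<exists>U. is_cover {0..n} U B \<and>
      (\<forall>i\<in>{0..n}. \<exists>s \<eta>. is_functor (U i) E s \<and> nat_transf (U i) B (P \<circ>\<^sub>F s) inclusion \<eta>))"

definition dsecat :: "('e, 'm) cat \<Rightarrow> ('o, 'a) cat \<Rightarrow> ('e, 'm, 'o, 'a) fctr \<Rightarrow> enat"
  where "dsecat E B P =
    (if \<exists>n. has_sectional_cover E B P n then enat (LEAST n. has_sectional_cover E B P n) else \<infinity>)"

text \<open>The constructions above do yield categories and functors.\<close>

lemma category_set_cat: "category set_cat"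
  by unfold_locales
    (auto simp: set_cat_def compose_def PiE_def Pi_def extensional_def fun_eq_iff restrict_def)

lemma is_functor_fcomp: "\<lbrakk>is_functor C D F; is_functor D E G\<rbrakk> \<Longrightarrow> is_functor C E (G \<circ>\<^sub>F F)"
  unfolding is_functor_def is_functor_axioms_def by (auto simp: fcomp_def)

lemma app_mem:
  assumes "is_functor C set_cat X" "f \<in> Ar C" "x \<in> omap X (Dom C f)"
  shows "app (amap X f) x \<in> omap X (Cod C f)"
proof -
  interpret is_functor C set_cat X by fact
  show ?thesis using amap_Ar[OF assms(2)] Dom_amap[OF assms(2)] Cod_amap[OF assms(2)] assms(3)
    by (auto simp: set_cat_def app_def)
qed

lemma app_Idn: "\<lbrakk>is_functor C set_cat X; c \<in> Ob C; x \<in> omap X c\<rbrakk> \<Longrightarrow> app (amap X (Idn C c)) x = x"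
  by (simp add: is_functor.amap_Idn set_cat_def app_def)

lemma app_Comp:
  assumes "is_functor C set_cat X" "f \<in> Ar C" "g \<in> Ar C" "Cod C f = Dom C g" "x \<in> omap X (Dom C f)"
  shows "app (amap X (Comp C g f)) x = app (amap X g) (app (amap X f) x)"
proof -
  interpret is_functor C set_cat X by fact
  show ?thesis using amap_Comp[OF assms(2-4)] Dom_amap[OF assms(2)] assms(5)
    by (auto simp: set_cat_def app_def compose_def split: prod.splits)
qed

lemma category_elements: assumes "is_functor C set_cat X" shows "category (elements C X)"
proof -
  interpret is_functor C set_cat X by fact
  show ?thesis
    by unfold_locales
     (auto simp: elements_def source.Idn_Ar source.Dom_Idn source.Cod_Idn source.Comp_Ar
      source.Dom_Comp source.Cod_Comp source.Comp_Idn_right source.Comp_Idn_left source.Comp_assoc 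
      app_Idn[OF assms] app_Comp[OF assms])
qed

lemma is_functor_elements_proj:
  assumes "is_functor C set_cat X" shows "is_functor (elements C X) C elements_proj"
proof -
  interpret is_functor C set_cat X by fact
  interpret E: category "elements C X" by (rule category_elements[OF assms])
  show ?thesis by unfold_locales (auto simp: elements_def elements_proj_def)
qed

end

theory Submission imports Defs begin

text \<open>
  A functor \<open>s\<close> from a subcategory \<open>U\<close> to the category of elements together with a transformation
  \<open>\<eta>\<close> from \<open>\<pi> s\<close> to the inclusion can be strictified: pushing the element \<open>x\<close> of \<open>s u = (a, x)\<close>
  forward along \<open>\<eta>\<^sub>u : a \<rightarrow> u\<close> gives a compatible family of elements over \<open>U\<close>. Compatible families
  pull back along \<open>F\<close> to the preimage of \<open>U\<close>, where they are strict sections of the projection,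
  and the preimages of a cover form a cover.
\<close>

text \<open>These are the elements of the limit of \<open>X\<close> restricted to \<open>U\<close>,
  or equivalently the strict sections of the projection over \<open>U\<close>.\<close>

definition compatible_family ::
    "('o, 'a) cat \<Rightarrow> ('o, 'a, 'x set, 'x set_map) fctr \<Rightarrow> ('o \<Rightarrow> 'x) \<Rightarrow> bool"
  where "compatible_family U X \<xi> \<longleftrightarrow> (\<forall>c\<in>Ob U. \<xi> c \<in> omap X c) \<and>
    (\<forall>f\<in>Ar U. app (amap X f) (\<xi> (Dom U f)) = \<xi> (Cod U f))"

definition family_section ::
    "('o, 'a) cat \<Rightarrow> ('o \<Rightarrow> 'x) \<Rightarrow> ('o, 'a, 'o \<times> 'x, ('o \<times> 'x) \<times> 'a \<times> ('o \<times> 'x)) fctr"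
  where "family_section C \<xi> = \<lparr>omap = (\<lambda>c. (c, \<xi> c)),
    amap = (\<lambda>f. ((Dom C f, \<xi> (Dom C f)), f, (Cod C f, \<xi> (Cod C f))))\<rparr>"

text \<open>Objects and arrows are cut down separately because \<open>U\<close> need not be full.
  The operations stay those of \<open>C\<close>, so agreement with \<open>C\<close> is
  definitional.\<close>

definition preimage ::
    "('o, 'a) cat \<Rightarrow> ('o, 'a, 'p, 'b) fctr \<Rightarrow> ('p, 'b) cat \<Rightarrow> ('o, 'a) cat"
  where "preimage C F U = C\<lparr>Ob := {c \<in> Ob C. omap F c \<in> Ob U}, Ar := {f \<in> Ar C. amap F f \<in> Ar U}\<rparr>"

lemma is_functor_inclusion: "subcategory U B \<Longrightarrow> is_functor U B inclusion"
  by (auto simp: subcategory_def is_functor_def is_functor_axioms_def inclusion_def)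

lemma subcategory_preimage:
  assumes "is_functor C D F" "subcategory U D"
  shows "subcategory (preimage C F U) C"
proof -
  interpret is_functor C D F by fact
  interpret U: category U using assms(2) by (simp add: subcategory_def)
  \<comment> \<open>Functoriality of \<open>F\<close> speaks of the operations of \<open>D\<close>,
    closure of \<open>U\<close> of its own; the two agree on arrows of \<open>U\<close>.\<close>
  have Dom: "omap F (Dom C f) = Dom U (amap F f)" and Cod: "omap F (Cod C f) = Cod U (amap F f)"
    if "f \<in> Ar C" "amap F f \<in> Ar U" for f
    using that assms(2) by (simp_all add: subcategory_def Dom_amap Cod_amap)
  have Idn: "amap F (Idn C c) \<in> Ar U" if "c \<in> Ob C" "omap F c \<in> Ob U" for c
    using that assms(2) U.Idn_Ar by (metis amap_Idn subcategory_def)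
  have Comp: "amap F (Comp C g f) \<in> Ar U"
    if "f \<in> Ar C" "amap F f \<in> Ar U" "g \<in> Ar C" "amap F g \<in> Ar U" "Cod C f = Dom C g" for f g
  proof -
    have "Cod U (amap F f) = Dom U (amap F g)"
      using that Dom[of g] Cod[of f] by simp
    then show ?thesis
      using that assms(2) U.Comp_Ar[of "amap F f" "amap F g"] by (simp add: subcategory_def amap_Comp)
  qed
  have "category (preimage C F U)"
    by unfold_locales
      (auto simp: preimage_def Dom Cod Idn Comp U.Dom_Ob U.Cod_Ob source.Dom_Ob source.Cod_Ob
        source.Idn_Ar source.Dom_Idn source.Cod_Idn source.Comp_Ar source.Dom_Comp source.Cod_Comp
        source.Comp_Idn_right source.Comp_Idn_left source.Comp_assoc)
  then show ?thesis
    by (auto simp: subcategory_def preimage_def source.category_axioms)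
qed

text \<open>The equation required at \<open>f\<close> is the one for \<open>\<xi>\<close> at
  \<open>amap F f\<close>. Strictness matters here: the components \<open>\<eta> u\<close> of a lax
  section are arrows of \<open>D\<close> that need not come from \<open>C\<close>.\<close>

lemma compatible_family_preimage:
  assumes "is_functor C D F" "subcategory U D" "compatible_family U X \<xi>"
  shows "compatible_family (preimage C F U) (X \<circ>\<^sub>F F) (\<xi> \<circ> omap F)"
proof -
  interpret is_functor C D F by fact
  show ?thesis
    using assms(2,3) Dom_amap Cod_amap
    by (auto simp: compatible_family_def preimage_def fcomp_def subcategory_def)
qed

text \<open>Apply \<open>X\<close> to the naturality square of \<open>\<eta>\<close> at
  \<open>f\<close>: going through \<open>f\<close> last or through \<open>\<eta>\<close> last
  carries the chosen element to the same place.\<close>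

lemma compatible_family_of_lax_section:
  assumes X: "is_functor D set_cat X" and U: "subcategory U D"
    and s: "is_functor U (elements D X) s"
    and \<eta>: "nat_transf U D (elements_proj \<circ>\<^sub>F s) inclusion \<eta>"
  shows "compatible_family U X (\<lambda>u. app (amap X (\<eta> u)) (snd (omap s u)))"
proof -
  interpret s: is_functor U "elements D X" s by fact
  interpret \<eta>: nat_transf U D "elements_proj \<circ>\<^sub>F s" inclusion \<eta> by fact
  have Dom: "Dom D (\<eta> u) = fst (omap s u)" and Cod: "Cod D (\<eta> u) = u" if "u \<in> Ob U" for u
    using \<eta>.Dom_component[OF that] \<eta>.Cod_component[OF that]
    by (simp_all add: fcomp_def elements_proj_def inclusion_def)
  have el: "snd (omap s u) \<in> omap X (Dom D (\<eta> u))" if "u \<in> Ob U" for u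
    using s.omap_Ob[OF that] by (auto simp: elements_def Dom that)
  have "app (amap X f) (app (amap X (\<eta> (Dom U f))) (snd (omap s (Dom U f))))
      = app (amap X (\<eta> (Cod U f))) (snd (omap s (Cod U f)))" if f: "f \<in> Ar U" for f
  proof -
    let ?u = "Dom U f" and ?v = "Cod U f"
    have u: "?u \<in> Ob U" and v: "?v \<in> Ob U"
      using f by (simp_all add: s.source.Dom_Ob s.source.Cod_Ob)
    have fD: "f \<in> Ar D" "Dom D f = ?u" using f U by (auto simp: subcategory_def)
    \<comment> \<open>Being an arrow of the category of elements, this triple supplies
      \<open>app (amap X g) x = y\<close>, the only relation between the chosen elements
      \<open>x\<close> and \<open>y\<close>.\<close>
    obtain a x g b y where g: "amap s f = ((a, x), g, (b, y))" by (metis surj_pair)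
    have g': "g \<in> Ar D" "Dom D g = a" "Cod D g = b" "app (amap X g) x = y" "x \<in> omap X a"
      using s.amap_Ar[OF f] g by (auto simp: elements_def)
    have su: "omap s ?u = (a, x)" and sv: "omap s ?v = (b, y)"
      using s.Dom_amap[OF f] s.Cod_amap[OF f] g by (auto simp: elements_def)
    have nat: "Comp D f (\<eta> ?u) = Comp D (\<eta> ?v) g"
      using \<eta>.naturality[OF f] g by (simp add: fcomp_def elements_proj_def inclusion_def)
    have "app (amap X f) (app (amap X (\<eta> ?u)) x) = app (amap X (Comp D f (\<eta> ?u))) x"
      using app_Comp[OF X \<eta>.component_Ar[OF u] fD(1)] el[OF u] su Cod[OF u] fD(2) by simp
    also have "\<dots> = app (amap X (\<eta> ?v)) y"
      unfolding nat using app_Comp[OF X g'(1) \<eta>.component_Ar[OF v]] g' Dom[OF v] sv by simp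
    finally show ?thesis using su sv by simp
  qed
  moreover have "app (amap X (\<eta> u)) (snd (omap s u)) \<in> omap X u" if "u \<in> Ob U" for u
    using app_mem[OF X \<eta>.component_Ar[OF that] el[OF that]] Cod[OF that] by simp
  ultimately show ?thesis by (simp add: compatible_family_def)
qed

text \<open>Compatibility of \<open>\<xi>\<close> is exactly the condition for the triples in
  \<open>family_section\<close> to be arrows of \<open>elements D X\<close>.\<close>

lemma is_functor_family_section:
  assumes X: "is_functor D set_cat X" and U: "subcategory U D" and \<xi>: "compatible_family U X \<xi>"
  shows "is_functor U (elements D X) (family_section U \<xi>)"
proof -
  interpret U: category U using U by (simp add: subcategory_def)
  interpret E: category "elements D X" by (rule category_elements[OF X])
  have sub: "f \<in> Ar U \<Longrightarrow> f \<in> Ar D" "c \<in> Ob U \<Longrightarrow> c \<in> Ob D"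
    "f \<in> Ar U \<Longrightarrow> Dom D f = Dom U f" "f \<in> Ar U \<Longrightarrow> Cod D f = Cod U f"
    "c \<in> Ob U \<Longrightarrow> Idn D c = Idn U c"
    "\<lbrakk>f \<in> Ar U; g \<in> Ar U; Cod U f = Dom U g\<rbrakk> \<Longrightarrow> Comp D g f = Comp U g f" for f g c
    using U by (auto simp: subcategory_def)
  show ?thesis
    using \<xi> by unfold_locales
      (auto simp: compatible_family_def elements_def family_section_def sub U.Dom_Ob U.Cod_Ob
        U.Dom_Idn U.Cod_Idn U.Dom_Comp U.Cod_Comp)
qed

text \<open>Projecting the section returns each object and arrow of \<open>U\<close> unchanged, so
  identities serve as components.\<close>

lemma nat_transf_family_section:
  assumes X: "is_functor D set_cat X" and U: "subcategory U D" and \<xi>: "compatible_family U X \<xi>"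
  shows "nat_transf U D (elements_proj \<circ>\<^sub>F family_section U \<xi>) inclusion (Idn D)"
proof -
  interpret i: is_functor U D inclusion using U by (rule is_functor_inclusion)
  interpret p: is_functor U D "elements_proj \<circ>\<^sub>F family_section U \<xi>"
    by (rule is_functor_fcomp[OF is_functor_family_section[OF assms] is_functor_elements_proj[OF X]])
  have "Comp D f (Idn D (Dom U f)) = Comp D (Idn D (Cod U f)) f" if "f \<in> Ar U" for f
    using that U i.target.Comp_Idn_left[of f] i.target.Comp_Idn_right[of f]
    by (auto simp: subcategory_def)
  moreover have "c \<in> Ob U \<Longrightarrow> c \<in> Ob D" for c
    using U by (auto simp: subcategory_def)
  ultimately show ?thesis
    by unfold_locales (simp_all add: fcomp_def elements_proj_def family_section_def inclusion_def
      i.target.Idn_Ar i.target.Dom_Idn i.target.Cod_Idn)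
qed

text \<open>An arrow \<open>f\<close> lies in the preimage of whichever member contains
  \<open>amap F f\<close>. The index set is kept, so the bound \<open>n\<close> does not
  grow.\<close>

lemma is_cover_preimage:
  assumes "is_functor C D F" "is_cover I U D"
  shows "is_cover I (\<lambda>i. preimage C F (U i)) C"
  using assms subcategory_preimage[OF assms(1)] is_functor.amap_Ar[OF assms(1)]
  by (auto simp: is_cover_def preimage_def)

lemma has_sectional_cover_restrict:
  assumes F: "is_functor C D F" and X: "is_functor D set_cat X"
    and "has_sectional_cover (elements D X) D elements_proj n"
  shows "has_sectional_cover (elements C (X \<circ>\<^sub>F F)) C elements_proj n"
proof -
  obtain U where U: "is_cover {0..n} U D"
    and lax: "\<And>i. i \<in> {0..n} \<Longrightarrow> \<exists>s \<eta>. is_functor (U i) (elements D X) s \<and>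
      nat_transf (U i) D (elements_proj \<circ>\<^sub>F s) inclusion \<eta>"
    using assms(3) unfolding has_sectional_cover_def by blast
  have FX: "is_functor C set_cat (X \<circ>\<^sub>F F)" by (rule is_functor_fcomp[OF F X])
  have "\<exists>s \<eta>. is_functor (preimage C F (U i)) (elements C (X \<circ>\<^sub>F F)) s \<and>
      nat_transf (preimage C F (U i)) C (elements_proj \<circ>\<^sub>F s) inclusion \<eta>" if i: "i \<in> {0..n}" for i
  proof -
    have Ui: "subcategory (U i) D" using U i by (simp add: is_cover_def)
    obtain \<xi> where "compatible_family (U i) X \<xi>"
      using lax[OF i] compatible_family_of_lax_section[OF X Ui] by blast
    then have "compatible_family (preimage C F (U i)) (X \<circ>\<^sub>F F) (\<xi> \<circ> omap F)"
      by (rule compatible_family_preimage[OF F Ui])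
    then show ?thesis
      using is_functor_family_section[OF FX subcategory_preimage[OF F Ui]]
        nat_transf_family_section[OF FX subcategory_preimage[OF F Ui]] by blast
  qed
  then show ?thesis
    using is_cover_preimage[OF F U] unfolding has_sectional_cover_def by blast
qed

theorem corollary7p8:
  fixes C :: "('c, 'f) cat" and D :: "('d, 'g) cat"
    and F :: "('c, 'f, 'd, 'g) fctr"
    and X :: "('d, 'g, 'x set, 'x set_map) fctr"
  assumes "category C" and "category D"
    and "is_functor C D F"
    and "is_functor D set_cat X"
  shows "dsecat (elements C (X \<circ>\<^sub>F F)) C elements_proj \<le> dsecat (elements D X) D elements_proj"
  \<comment> \<open>If some \<open>n\<close> works over \<open>D\<close>, the least such
    \<open>n\<close> also works over \<open>C\<close> and bounds the least one there; otherwise the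
    right-hand side is \<open>\<infinity>\<close>.\<close>
  using has_sectional_cover_restrict[OF assms(3,4)]
  by (auto simp: dsecat_def intro: Least_le LeastI)

end
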